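(* Let $n\ge 1$, let $\mathscr{A},\mathscr{B}\subseteq\mathbb{N}^n$ be finite sets, let $\gamma\in\mathbb{N}^n$, and let $c_{\alpha}>0$ for $\alpha\in\mathscr{A}$ and $d_{\beta}>0$ for $\beta\in\mathscr{B}$ be real numbers. Let $\Delta=\mathrm{conv}(\mathscr{A})$ and suppose $\mathscr{B}\cup\{\gamma\}\subseteq\Delta^{\circ}\cap\mathbb{N}^n$. Assume that $\dim(\Delta)=n$, that $\Delta$ is simple at some vertex, and that $\sum_{\alpha\in\mathscr{A}}c_{\alpha}\mathbf{x}^{\alpha}-\sum_{\beta\in\mathscr{B}}d_{\beta}\mathbf{x}^{\beta}$ is nonnegative over $\mathbb{R}_{+}^n$. Then the system of $n$ polynomial equations (written as one vector equation in $\mathbb{R}^n$) $$\sum_{\alpha\in\mathscr{A}}c_{\alpha}(\alpha-\gamma)\mathbf{x}^{\alpha}-\sum_{\beta\in\mathscr{B}}d_{\beta}(\beta-\gamma)\mathbf{x}^{\beta}=\mathbf{0}$$ has at least one positive real zero, i.e. a solution $\mathbf{x}\in\mathbb{R}_+^n$.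
   Context: $\mathbb{N}=\{0,1,2,\ldots\}$; $\mathbb{R}_+$ is the set of (strictly) positive real numbers. For $\alpha=(\alpha_1,\ldots,\alpha_n)$, $\mathbf{x}^{\alpha}=x_1^{\alpha_1}\cdots x_n^{\alpha_n}$. $\mathrm{conv}$ denotes convex hull, and for a polytope $P$, $P^{\circ}$ denotes its interior. A polynomial $g$ is nonnegative over a set $A\subseteq\mathbb{R}^n$ if $g(\mathbf{x})\ge 0$ for all $\mathbf{x}\in A$. A polytope $\Delta$ of dimension $d$ is called simple at a vertex $v$ of $\Delta$ if $v$ is the intersection of precisely $d$ edges of $\Delta$ (i.e. exactly $d$ edges of $\Delta$ contain $v$). *)

theory Defs
  imports "HOL-Analysis.Analysis"
begin

definition rvec :: "nat ^ 'n \<Rightarrow> real ^ 'n" where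
  "rvec \<alpha> = (\<chi> i. real (\<alpha> $ i))"

definition monomial :: "real ^ 'n \<Rightarrow> nat ^ 'n \<Rightarrow> real" where
  "monomial x \<alpha> = (\<Prod>i\<in>UNIV. (x $ i) ^ (\<alpha> $ i))"

definition positive_orthant :: "(real ^ 'n) set" where
  "positive_orthant = {x. \<forall>i. 0 < x $ i}"

definition nonnegative_over :: "('a \<Rightarrow> real) \<Rightarrow> 'a set \<Rightarrow> bool" where
  "nonnegative_over g S \<longleftrightarrow> (\<forall>x\<in>S. 0 \<le> g x)"

text \<open>Intended for polytopes \<open>P\<close>: these have finitely many faces, so that the
  cardinality below never takes the default value of an infinite set.
  The vertices of a polytope are its extreme points.\<close>

definition simple_at :: "'a::euclidean_space set \<Rightarrow> 'a \<Rightarrow> bool" where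
  "simple_at P v \<longleftrightarrow>
     v extreme_point_of P \<and> int (card {e. e edge_of P \<and> v \<in> e}) = aff_dim P"

end

theory Submission
  imports Defs
begin

text \<open>
  Substituting \<open>x\<^sub>k = exp y\<^sub>k\<close> turns the monomial of exponent \<open>\<alpha>\<close> into \<open>exp (\<alpha> \<bullet> y)\<close>, and the
  vector equation, divided by \<open>exp (\<gamma> \<bullet> y)\<close>, says that the gradient of
  \<open>g y = (\<Sum>\<alpha>\<in>A. c \<alpha> * exp ((\<alpha> - \<gamma>) \<bullet> y)) - (\<Sum>\<beta>\<in>B. d \<beta> * exp ((\<beta> - \<gamma>) \<bullet> y))\<close>
  vanishes at \<open>y\<close>. So a global minimum of \<open>g\<close> gives a solution, and one exists because \<open>g\<close> is
  large outside a ball: as \<open>\<gamma>\<close> and all \<open>\<beta>\<close> are interior to the convex hull of \<open>A\<close>, there is an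
  \<open>e > 0\<close> such that for each \<open>y\<close> the largest value \<open>\<alpha> \<bullet> y\<close> with \<open>\<alpha> \<in> A\<close> exceeds \<open>\<gamma> \<bullet> y\<close> and all
  \<open>\<beta> \<bullet> y\<close> by at least \<open>e * norm y\<close> (lemma \<open>finite_interior_hull_support_gap\<close>). Hence the
  positive term of that \<open>\<alpha>\<close> dominates the negative terms and tends to infinity with \<open>norm y\<close>.
\<close>

lemma interior_hull_support_gap:
  fixes q :: "'a::euclidean_space"
  assumes "q \<in> interior (convex hull S)"
  shows "\<exists>e>0. \<forall>y. \<exists>s\<in>S. q \<bullet> y + e * norm y \<le> s \<bullet> y"
proof -
  obtain e where e: "e > 0" "cball q e \<subseteq> convex hull S"
    using assms by (auto simp: mem_interior_cball)
  have "\<exists>s\<in>S. q \<bullet> y + e * norm y \<le> s \<bullet> y" for y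
  proof (rule ccontr)
    assume "\<not> ?thesis"
    then have "S \<subseteq> {s. y \<bullet> s < q \<bullet> y + e * norm y}"
      by (auto simp: not_le inner_commute)
    then have "convex hull S \<subseteq> {s. y \<bullet> s < q \<bullet> y + e * norm y}"
      by (intro hull_minimal convex_halfspace_lt)
    \<comment> \<open>For \<open>y = 0\<close> the point is \<open>q\<close> itself, which the empty set \<open>{s. 0 < 0}\<close> does not contain.\<close>
    moreover have "q + e *\<^sub>R sgn y \<in> cball q e"
      using e(1) by (simp add: dist_norm norm_sgn)
    ultimately have "y \<bullet> (q + e *\<^sub>R sgn y) < q \<bullet> y + e * norm y"
      using e(2) by blast
    moreover have "y \<bullet> sgn y = norm y"
      by (cases "y = 0") (simp_all add: sgn_div_norm dot_square_norm power2_eq_square)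
    ultimately show False
      by (simp add: inner_add_right inner_commute)
  qed
  then show ?thesis using e(1) by blast
qed

lemma finite_interior_hull_support_gap:
  fixes T :: "'a::euclidean_space set"
  assumes "finite T" "T \<subseteq> interior (convex hull S)"
  shows "\<exists>e>0. \<forall>t\<in>T. \<forall>y. \<exists>s\<in>S. t \<bullet> y + e * norm y \<le> s \<bullet> y"
  using assms
proof (induction T rule: finite_induct)
  case empty
  show ?case by (auto intro: exI[of _ 1])
next
  case (insert q T)
  obtain e where e: "e > 0" "\<And>t y. t \<in> T \<Longrightarrow> \<exists>s\<in>S. t \<bullet> y + e * norm y \<le> s \<bullet> y"
    using insert by auto
  obtain e' where e': "e' > 0" "\<And>y. \<exists>s\<in>S. q \<bullet> y + e' * norm y \<le> s \<bullet> y"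
    using interior_hull_support_gap insert.prems by (metis insert_subset)
  have le: "min e e' * norm y \<le> e * norm y" "min e e' * norm y \<le> e' * norm y" for y :: 'a
    by (auto intro!: mult_right_mono)
  have "\<exists>s\<in>S. t \<bullet> y + min e e' * norm y \<le> s \<bullet> y" if "t \<in> insert q T" for t y
  proof -
    consider "t = q" | "t \<in> T" using \<open>t \<in> insert q T\<close> by blast
    then obtain s where "s \<in> S"
      "t \<bullet> y + e * norm y \<le> s \<bullet> y \<or> t \<bullet> y + e' * norm y \<le> s \<bullet> y"
      by cases (use e(2) e'(2) in blast)+
    then show ?thesis using le[of y] by (intro bexI[of _ s]) auto
  qed
  then show ?case using e(1) e'(1) by (intro exI[of _ "min e e'"]) auto
qed

text \<open>The critical point statement for exponential sums with arbitrary exponent vectors, where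
  \<open>p\<close> sends an index to its exponent vector.\<close>

lemma exp_sum_critical_point:
  fixes p :: "'i \<Rightarrow> 'a::euclidean_space"
  assumes fin: "finite I" "finite J"
    and c: "\<And>i. i \<in> I \<Longrightarrow> 0 < c i" and d: "\<And>j. j \<in> J \<Longrightarrow> 0 \<le> d j"
    and q: "q \<in> interior (convex hull (p ` I))"
    and J: "p ` J \<subseteq> interior (convex hull (p ` I))"
  shows "\<exists>y. (\<Sum>i\<in>I. (c i * exp ((p i - q) \<bullet> y)) *\<^sub>R (p i - q)) -
             (\<Sum>j\<in>J. (d j * exp ((p j - q) \<bullet> y)) *\<^sub>R (p j - q)) = 0"
proof -
  define g where "g y = (\<Sum>i\<in>I. c i * exp ((p i - q) \<bullet> y)) - (\<Sum>j\<in>J. d j * exp ((p j - q) \<bullet> y))"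
    for y
  define D where "D = (\<Sum>j\<in>J. d j)"
  define m where "m = Min (c ` I)"
  have ne: "I \<noteq> {}" using q by auto
  have m: "m > 0" "\<And>i. i \<in> I \<Longrightarrow> m \<le> c i"
    unfolding m_def using fin(1) ne c by auto
  obtain e where e: "e > 0"
    "\<And>t y. t \<in> insert q (p ` J) \<Longrightarrow> \<exists>s\<in>p ` I. t \<bullet> y + e * norm y \<le> s \<bullet> y"
    using finite_interior_hull_support_gap[of "insert q (p ` J)" "p ` I"] fin(2) q J
    by (metis finite_imageI finite_insert insert_subset)
  define K where "K = max (2 * D / m) (2 * g 0 / m)"
  \<comment> \<open>The radius is chosen so that \<open>exp (e * norm y) \<ge> K\<close> outside the ball; there half of the
    dominating positive term absorbs the negative terms and the other half is at least \<open>g 0\<close>.\<close>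
  define R where "R = \<bar>K\<bar> / e"
  have large: "g 0 \<le> g y" if y: "R \<le> norm y" for y
  proof -
    have "Max ((\<lambda>i. p i \<bullet> y) ` I) \<in> (\<lambda>i. p i \<bullet> y) ` I"
      using fin(1) ne by (intro Max_in) auto
    then obtain k where "k \<in> I" "Max ((\<lambda>i. p i \<bullet> y) ` I) = p k \<bullet> y"
      by blast
    moreover from this have "p i \<bullet> y \<le> p k \<bullet> y" if "i \<in> I" for i
      using Max_ge[of "(\<lambda>i. p i \<bullet> y) ` I" "p i \<bullet> y"] fin(1) that by simp
    ultimately have k: "k \<in> I" "\<And>i. i \<in> I \<Longrightarrow> p i \<bullet> y \<le> p k \<bullet> y"
      by blast+
    define M where "M = (p k - q) \<bullet> y"
    define t where "t = exp (e * norm y)"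
    have gap: "z \<bullet> y + e * norm y \<le> p k \<bullet> y" if "z \<in> insert q (p ` J)" for z
      using e(2)[OF that, of y] k(2) by fastforce
    have "\<bar>K\<bar> \<le> e * norm y"
      using y e(1) by (simp add: R_def field_simps)
    then have "K \<le> t"
      using exp_ge_add_one_self[of "e * norm y"] unfolding t_def by linarith
    then have t: "2 * D \<le> m * t" "2 * g 0 \<le> m * t"
      using m(1) by (auto simp: K_def field_simps)
    have tpos: "t > 0" by (simp add: t_def)
    have tM: "t \<le> exp M"
      using gap[of q] by (simp add: t_def M_def inner_diff_left)
    have "m * exp M \<le> c k * exp ((p k - q) \<bullet> y)"
      using m(2)[OF k(1)] by (simp add: M_def)
    also have "\<dots> \<le> (\<Sum>i\<in>I. c i * exp ((p i - q) \<bullet> y))"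
      using k(1) fin(1) c by (intro member_le_sum) (auto intro!: mult_nonneg_nonneg less_imp_le)
    finally have pos: "m * exp M \<le> (\<Sum>i\<in>I. c i * exp ((p i - q) \<bullet> y))" .
    have "(\<Sum>j\<in>J. d j * exp ((p j - q) \<bullet> y)) \<le> (\<Sum>j\<in>J. d j * (exp M / t))"
    proof (intro sum_mono mult_left_mono d)
      fix j assume "j \<in> J"
      then have "(p j - q) \<bullet> y \<le> M - e * norm y"
        using gap[of "p j"] by (simp add: M_def inner_diff_left)
      then show "exp ((p j - q) \<bullet> y) \<le> exp M / t"
        by (simp add: t_def flip: exp_diff)
    qed
    also have "\<dots> = D * (exp M / t)"
      unfolding D_def by (rule sum_distrib_right[symmetric])
    also have "\<dots> \<le> m * t / 2 * (exp M / t)"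
      using t(1) tpos by (intro mult_right_mono) auto
    also have "\<dots> = m * exp M / 2"
      using tpos by simp
    finally have neg: "(\<Sum>j\<in>J. d j * exp ((p j - q) \<bullet> y)) \<le> m * exp M / 2" .
    have "m * t \<le> m * exp M" using tM m(1) by simp
    with t(2) pos neg show ?thesis unfolding g_def[of y] by linarith
  qed
  have "continuous_on (cball 0 R) g"
    unfolding g_def by (intro continuous_intros)
  moreover have "R \<ge> 0" using e(1) by (simp add: R_def)
  ultimately obtain y0 where y0: "\<forall>y\<in>cball 0 R. g y0 \<le> g y"
    using continuous_attains_inf[of "cball 0 R" g] by auto
  have min: "g y0 \<le> g y" for y
    using bspec[OF y0, of y] bspec[OF y0, of 0] large[of y] \<open>R \<ge> 0\<close>
    by (cases "norm y \<le> R") auto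
  define v where "v = (\<Sum>i\<in>I. (c i * exp ((p i - q) \<bullet> y0)) *\<^sub>R (p i - q)) -
      (\<Sum>j\<in>J. (d j * exp ((p j - q) \<bullet> y0)) *\<^sub>R (p j - q))"
  have summand: "((\<lambda>y. a * exp (w \<bullet> y)) has_derivative
      (\<lambda>h. ((a * exp (w \<bullet> y0)) *\<^sub>R w) \<bullet> h)) (at y0)"
    for a and w :: 'a
    by (auto intro!: derivative_eq_intros)
  have "(g has_derivative (\<lambda>h. v \<bullet> h)) (at y0)"
    unfolding g_def v_def inner_diff_left[of "sum _ _"] inner_sum_left
    by (intro has_derivative_diff has_derivative_sum summand)
  then have "(\<lambda>h. v \<bullet> h) = (\<lambda>h. 0)"
    using min by (intro differential_zero_maxmin[of y0 UNIV g]) auto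
  from fun_cong[OF this, of v] have "v = 0" by simp
  then show ?thesis unfolding v_def by blast
qed

lemma monomial_exp: "monomial (\<chi> i. exp (y $ i)) \<alpha> = exp (rvec \<alpha> \<bullet> y)"
  by (simp add: monomial_def rvec_def inner_vec_def exp_sum exp_of_nat_mult)

theorem theorem4p8:
  fixes A B :: "(nat ^ 'n) set" and \<gamma> :: "nat ^ 'n"
    and c d :: "nat ^ 'n \<Rightarrow> real" and \<Delta> :: "(real ^ 'n) set"
  assumes "finite A" and "finite B"
    and "\<And>\<alpha>. \<alpha> \<in> A \<Longrightarrow> c \<alpha> > 0" and "\<And>\<beta>. \<beta> \<in> B \<Longrightarrow> d \<beta> > 0"
    and "\<Delta> = convex hull (rvec ` A)"
    and "rvec ` (B \<union> {\<gamma>}) \<subseteq> interior \<Delta>"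
    and "aff_dim \<Delta> = int CARD('n)"
    and "\<exists>v. simple_at \<Delta> v"
    and "nonnegative_over
           (\<lambda>x. (\<Sum>\<alpha>\<in>A. c \<alpha> * monomial x \<alpha>) - (\<Sum>\<beta>\<in>B. d \<beta> * monomial x \<beta>))
           positive_orthant"
  shows "\<exists>x\<in>positive_orthant.
           (\<Sum>\<alpha>\<in>A. (c \<alpha> * monomial x \<alpha>) *\<^sub>R (rvec \<alpha> - rvec \<gamma>)) -
           (\<Sum>\<beta>\<in>B. (d \<beta> * monomial x \<beta>) *\<^sub>R (rvec \<beta> - rvec \<gamma>)) = 0"
proof -
  obtain y where y:
    "(\<Sum>\<alpha>\<in>A. (c \<alpha> * exp ((rvec \<alpha> - rvec \<gamma>) \<bullet> y)) *\<^sub>R (rvec \<alpha> - rvec \<gamma>)) -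
     (\<Sum>\<beta>\<in>B. (d \<beta> * exp ((rvec \<beta> - rvec \<gamma>) \<bullet> y)) *\<^sub>R (rvec \<beta> - rvec \<gamma>)) = 0" (is "?S = 0")
    using exp_sum_critical_point[of A B c d "rvec \<gamma>" rvec] assms by (auto simp: less_imp_le)
  define x :: "real ^ 'n" where "x = (\<chi> i. exp (y $ i))"
  have mon: "monomial x \<alpha> = exp (rvec \<gamma> \<bullet> y) * exp ((rvec \<alpha> - rvec \<gamma>) \<bullet> y)" for \<alpha>
    by (simp add: x_def monomial_exp inner_diff_left flip: exp_add)
  have "(\<Sum>\<alpha>\<in>A. (c \<alpha> * monomial x \<alpha>) *\<^sub>R (rvec \<alpha> - rvec \<gamma>)) -
        (\<Sum>\<beta>\<in>B. (d \<beta> * monomial x \<beta>) *\<^sub>R (rvec \<beta> - rvec \<gamma>)) = exp (rvec \<gamma> \<bullet> y) *\<^sub>R ?S"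
    by (simp add: mon scaleR_diff_right scaleR_sum_right mult_ac)
  moreover have "x \<in> positive_orthant"
    by (simp add: x_def positive_orthant_def)
  ultimately show ?thesis using y by auto
qed

end
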